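(* Let $G$ be a graph with $n(G)\ge 2$ such that both $G$ and $\overline{G}$ are connected. Then $\mathrm{gp}(G\overline{G})=n(G)+1$ if and only if $\mathrm{rad}(G)=2$ and there exists $v\in C(G)$ such that (i) $\overline{N_G(v)}$ is a $3$-general position set in $\overline{G}$ and $N_G^2(v)$ is a $3$-general position set in $G$, and (ii) for each $x\in N_G(v)$ there exists $y\in N_G^2(v)$ such that $xy\notin E(G)$.
   Context: Graphs are finite and simple; $n(G)$ is the number of vertices of $G$ and $\overline{G}$ is the complement of $G$. The complementary prism $G\overline{G}$ is the graph formed from the disjoint union of $G$ and $\overline{G}$ by adding, for each $u\in V(G)$, an edge between $u$ and the corresponding vertex $\overline{u}$ of $\overline{G}$. For $X\subseteq V(G)$, $\overline{X}=\{\overline{x}: x\in X\}\subseteq V(\overline{G})$. A geodesic is a shortest path between its two end vertices. A set $S$ of vertices of a graph $H$ is a general position set if no element of $S$ lies on a geodesic of $H$ between two other elements of $S$; $\mathrm{gp}(H)$ is the maximum cardinality of a general position set of $H$. A set $S\subseteq V(H)$ is a $3$-general position set in $H$ if no three vertices from $S$ lie on a common geodesic of $H$ of length at most $3$. The eccentricity of $u$ is $\mathrm{ecc}_G(u)=\max\{d_G(u,v): v\in V(G)\}$, $\mathrm{rad}(G)=\min\{\mathrm{ecc}_G(v): v\in V(G)\}$, and $C(G)=\{v\in V(G): \mathrm{ecc}_G(v)=\mathrm{rad}(G)\}$. $N_G(v)$ is the set of neighbours of $v$ in $G$, and $N_G^2(v)=\{u\in V(G): d_G(u,v)=2\}$.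 *)

theory Defs
  imports "Graph_Theory.Graph_Theory"
begin

text \<open>
  Finite simple graphs are the locale \<open>pair_graph\<close> of the Graph_Theory library: every edge
  \<open>uv\<close> is present as the two arcs \<open>(u, v)\<close> and \<open>(v, u)\<close>.
\<close>

definition complement :: "'a pair_pre_digraph \<Rightarrow> 'a pair_pre_digraph" where
  "complement G = \<lparr> pverts = pverts G,
     parcs = {(u, v). u \<in> pverts G \<and> v \<in> pverts G \<and> u \<noteq> v \<and> (u, v) \<notin> parcs G} \<rparr>"

text \<open>
  The complement has the same vertex set as the graph, so a vertex \<open>u\<close> and its copy in the
  complement are identified there. In the complementary prism the two copies are told apart
  by the tags \<open>Inl\<close> (vertices of the graph) and \<open>Inr\<close> (vertices of its complement).
\<close>

definition comp_prism :: "'a pair_pre_digraph \<Rightarrow> ('a + 'a) pair_pre_digraph" where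
  "comp_prism G = \<lparr> pverts = pverts G <+> pverts (complement G),
     parcs = {(Inl u, Inl v) | u v. (u, v) \<in> parcs G}
           \<union> {(Inr u, Inr v) | u v. (u, v) \<in> parcs (complement G)}
           \<union> {(Inl u, Inr u) | u. u \<in> pverts G}
           \<union> {(Inr u, Inl u) | u. u \<in> pverts G} \<rparr>"

text \<open>
  The distance is meaningful for vertices in the same component only; otherwise the set of
  lengths is empty and \<open>LEAST\<close> yields an unspecified number.
\<close>

definition vdist :: "'a pair_pre_digraph \<Rightarrow> 'a \<Rightarrow> 'a \<Rightarrow> nat" where
  "vdist G u v = (LEAST n. \<exists>p. vpath p G \<and> hd p = u \<and> last p = v \<and> vwalk_length p = n)"

definition geodesic :: "'a pair_pre_digraph \<Rightarrow> 'a vwalk \<Rightarrow> bool" where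
  "geodesic G p \<longleftrightarrow> vpath p G \<and> vwalk_length p = vdist G (hd p) (last p)"

definition gp_set :: "'a pair_pre_digraph \<Rightarrow> 'a set \<Rightarrow> bool" where
  "gp_set G S \<longleftrightarrow> S \<subseteq> pverts G \<and>
     (\<forall>x \<in> S. \<forall>u \<in> S - {x}. \<forall>v \<in> S - {x}. u \<noteq> v \<longrightarrow>
        \<not> (\<exists>p. geodesic G p \<and> hd p = u \<and> last p = v \<and> x \<in> set p))"

definition gp :: "'a pair_pre_digraph \<Rightarrow> nat" where
  "gp G = Max {card S | S. gp_set G S}"

definition three_gp_set :: "'a pair_pre_digraph \<Rightarrow> 'a set \<Rightarrow> bool" where
  "three_gp_set G S \<longleftrightarrow> S \<subseteq> pverts G \<and>
     \<not> (\<exists>x \<in> S. \<exists>y \<in> S. \<exists>z \<in> S. x \<noteq> y \<and> x \<noteq> z \<and> y \<noteq> z \<and>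
        (\<exists>p. geodesic G p \<and> vwalk_length p \<le> 3 \<and> {x, y, z} \<subseteq> set p))"

definition ecc :: "'a pair_pre_digraph \<Rightarrow> 'a \<Rightarrow> nat" where
  "ecc G u = Max {vdist G u v | v. v \<in> pverts G}"

definition rad :: "'a pair_pre_digraph \<Rightarrow> nat" where
  "rad G = Min {ecc G v | v. v \<in> pverts G}"

definition centre :: "'a pair_pre_digraph \<Rightarrow> 'a set" where
  "centre G = {v \<in> pverts G. ecc G v = rad G}"

definition nbhd :: "'a pair_pre_digraph \<Rightarrow> 'a \<Rightarrow> 'a set" where
  "nbhd G v = {u \<in> pverts G. (v, u) \<in> parcs G}"

definition nbhd2 :: "'a pair_pre_digraph \<Rightarrow> 'a \<Rightarrow> 'a set" where
  "nbhd2 G v = {u \<in> pverts G. vdist G u v = 2}"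

end

theory Submission
  imports Defs
begin

text \<open>
  Write a vertex set of the prism as \<open>A <+> B\<close>. Distances in the prism are explicit: inside each
  copy they are the distances of that copy truncated at 3, and a vertex of one copy has distance
  1 to its partner and 2 to every other vertex of the other copy. Hence \<open>A <+> B\<close> is in general
  position iff \<open>A\<close> and \<open>B\<close> are 3-general position sets in their copies and each \<open>v \<in> A \<inter> B\<close> has
  distance exactly 2 to the rest of \<open>A\<close> in the graph and to the rest of \<open>B\<close> in the complement.
  Two vertices of \<open>A \<inter> B\<close> would thus be adjacent neither in the graph nor in its complement, so
  the cardinality is at most \<open>n + 1\<close>. Equality forces \<open>A \<inter> B = {v}\<close> and \<open>A \<union> B\<close> to be everything,
  so \<open>A - {v}\<close> is the second neighbourhood and \<open>B - {v}\<close> the neighbourhood of \<open>v\<close>.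
\<close>

lemma in_Plus_iff [simp]:
  "Inl a \<in> A <+> B \<longleftrightarrow> a \<in> A" "Inr b \<in> A <+> B \<longleftrightarrow> b \<in> B"
  by auto

section \<open>Walks and distance\<close>

lemma length_vwalk_to_vpath_le: "length (vwalk_to_vpath p) \<le> length p"
proof (induct p rule: vwalk_to_vpath_induct3)
  case (in_set x xs)
  then show ?case
    using length_dropWhile_le[of "\<lambda>y. y \<noteq> x" xs] by simp
qed auto

text \<open>Cutting the loops out of a walk leaves a path that is no longer. So the walks obtained
  by joining and reversing bound the distance directly, although \<open>vdist\<close> minimizes over
  paths.\<close>

lemma vdist_le:
  fixes G :: "'a pair_pre_digraph"
  assumes "vwalk p G"
  shows "vdist G (hd p) (last p) \<le> length p - 1"
proof -
  have "vdist G (hd p) (last p) \<le> vwalk_length (vwalk_to_vpath p)"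
    unfolding vdist_def
    by (rule Least_le) (use assms vwalk_to_vpath_vpath vwalk_to_vpath_hd vwalk_to_vpath_last in blast)
  then show ?thesis
    using length_vwalk_to_vpath_le[of p] by simp
qed

lemma vdist_refl [simp]: "u \<in> pverts G \<Longrightarrow> vdist G u u = 0"
  using vdist_le[of "[u]" G] by simp

section \<open>The metric of a connected graph\<close>

locale connected_pair_graph = pair_graph +
  assumes strongly_connected: "strongly_connected G"
begin

text \<open>Reachability supplies a path, so the \<open>LEAST\<close> in \<open>vdist\<close> ranges
  over a nonempty set and is attained.\<close>

lemma ex_geodesic:
  assumes "u \<in> pverts G" "v \<in> pverts G"
  obtains p where "geodesic G p" "hd p = u" "last p = v"
proof -
  have "u \<rightarrow>\<^sup>*\<^bsub>G\<^esub> v"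
    using strongly_connected assms by (auto simp: strongly_connected_def)
  then obtain p where "vpath p G" "hd p = u" "last p = v"
    by (auto simp: reachable_vpath_conv)
  then have "\<exists>n p. vpath p G \<and> hd p = u \<and> last p = v \<and> vwalk_length p = n"
    by blast
  from LeastI_ex[OF this] show ?thesis
    using that unfolding geodesic_def vdist_def by blast
qed

lemma geodesicD:
  assumes "geodesic G p"
  shows "vwalk p G" "length p = Suc (vdist G (hd p) (last p))" "p \<noteq> []"
  using assms by (cases p; auto simp: geodesic_def vpath_def vwalk_def)+

text \<open>Drop the first vertex of a geodesic, or prepend \<open>u\<close> to a geodesic from
  \<open>w\<close>; in the latter case \<open>u\<close> may recur, which \<open>vdist_le\<close>
  tolerates. Iteration turns distance at most 1 or 2 into statements about arcs.\<close>

lemma vdist_le_Suc_iff: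
  assumes "u \<in> pverts G" "v \<in> pverts G"
  shows "vdist G u v \<le> Suc k \<longleftrightarrow> u = v \<or> (\<exists>w. (u, w) \<in> parcs G \<and> vdist G w v \<le> k)"
proof
  assume le: "vdist G u v \<le> Suc k"
  obtain p where p: "geodesic G p" "hd p = u" "last p = v"
    using ex_geodesic[OF assms] .
  note g = geodesicD[OF p(1)]
  show "u = v \<or> (\<exists>w. (u, w) \<in> parcs G \<and> vdist G w v \<le> k)"
  proof (cases "tl p")
    case Nil
    then show ?thesis using p g by (cases p) auto
  next
    case (Cons w q)
    then have pe: "p = u # w # q"
      using p g by (cases p) auto
    with g have "(u, w) \<in> parcs G" "vwalk (w # q) G"
      by auto
    with vdist_le[of "w # q" G] pe p g le show ?thesis by auto
  qed
next
  assume "u = v \<or> (\<exists>w. (u, w) \<in> parcs G \<and> vdist G w v \<le> k)"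
  then show "vdist G u v \<le> Suc k"
  proof
    assume "\<exists>w. (u, w) \<in> parcs G \<and> vdist G w v \<le> k"
    then obtain w where w: "(u, w) \<in> parcs G" "vdist G w v \<le> k" by blast
    obtain p where p: "geodesic G p" "hd p = w" "last p = v"
      using ex_geodesic assms w in_arcsD2 by metis
    note g = geodesicD[OF p(1)]
    have "vwalk (u # p) G"
      using g p w assms by (intro vwalk_consI) auto
    from vdist_le[OF this] show ?thesis using g p w by simp
  qed (use assms in auto)
qed

lemma vdist_eq_0_iff:
  assumes "u \<in> pverts G" "v \<in> pverts G"
  shows "vdist G u v = 0 \<longleftrightarrow> u = v"
proof
  assume "vdist G u v = 0"
  obtain p where "geodesic G p" "hd p = u" "last p = v"
    using ex_geodesic[OF assms] .
  with \<open>vdist G u v = 0\<close> geodesicD[of p] show "u = v"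
    by (cases p) auto
qed (use assms in auto)

lemma vdist_eq_1_iff:
  assumes "u \<in> pverts G" "v \<in> pverts G"
  shows "vdist G u v = Suc 0 \<longleftrightarrow> (u, v) \<in> parcs G"
proof -
  have "vdist G u v = Suc 0 \<longleftrightarrow> vdist G u v \<le> Suc 0 \<and> u \<noteq> v"
    using vdist_eq_0_iff[OF assms] by linarith
  also have "\<dots> \<longleftrightarrow> (u, v) \<in> parcs G"
    using assms no_loops' vdist_eq_0_iff in_arcsD2 by (auto simp: vdist_le_Suc_iff)
  finally show ?thesis .
qed

lemma vdist_le_1_iff:
  assumes "u \<in> pverts G" "v \<in> pverts G"
  shows "vdist G u v \<le> 1 \<longleftrightarrow> u = v \<or> (u, v) \<in> parcs G"
  using vdist_eq_0_iff[OF assms] vdist_eq_1_iff[OF assms] by (auto simp: le_Suc_eq)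

lemma vdist_le_2_iff:
  assumes "u \<in> pverts G" "v \<in> pverts G"
  shows "vdist G u v \<le> 2 \<longleftrightarrow>
    u = v \<or> (u, v) \<in> parcs G \<or> (\<exists>w. (u, w) \<in> parcs G \<and> (w, v) \<in> parcs G)"
  using vdist_le_Suc_iff[OF assms, of 1] vdist_le_1_iff[OF _ assms(2)] in_arcsD2
  by (auto simp: numeral_2_eq_2)

lemma vdist_triangle:
  assumes "u \<in> pverts G" "x \<in> pverts G" "v \<in> pverts G"
  shows "vdist G u v \<le> vdist G u x + vdist G x v"
proof -
  obtain p where p: "geodesic G p" "hd p = u" "last p = x" using assms ex_geodesic by blast
  obtain q where q: "geodesic G q" "hd q = x" "last q = v" using assms ex_geodesic by blast
  note g = geodesicD[OF p(1)] geodesicD[OF q(1)]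
  have j: "joinable p q" using p q g by (auto simp: joinable_def)
  have "vwalk (p \<oplus> q) G" using g j by (intro vwalk_joinI_vwalk) auto
  from vdist_le[OF this] show ?thesis
    using p q g j by (simp add: vwalk_join_hd vwalk_join_last) (simp add: vwalk_join_def)
qed

lemma vdist_commute:
  assumes "u \<in> pverts G" "v \<in> pverts G"
  shows "vdist G u v = vdist G v u"
proof -
  have "vdist G b a \<le> vdist G a b" if ab: "a \<in> pverts G" "b \<in> pverts G" for a b
  proof -
    obtain p where p: "geodesic G p" "hd p = a" "last p = b" using ab ex_geodesic by blast
    note g = geodesicD[OF p(1)]
    have "vwalk (rev p) G"
      using g(1) by (rule vwalk_rev_ex[OF pair_sym_arcs])
    from vdist_le[OF this] show ?thesis using p g by (simp add: hd_rev last_rev)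
  qed
  with assms show ?thesis by (meson antisym)
qed

text \<open>If the segment from \<open>i\<close> to \<open>j\<close> could be shortened, the
  triangle inequality through \<open>p ! i\<close> and \<open>p ! j\<close> would put the ends of
  \<open>p\<close> closer together than the length of \<open>p\<close>.\<close>

lemma vdist_geodesic_nth:
  assumes p: "geodesic G p" and ij: "i \<le> j" "j < length p"
  shows "vdist G (p ! i) (p ! j) = j - i"
proof -
  note g = geodesicD[OF p]
  have le: "vdist G (p ! a) (p ! b) \<le> b - a" if "a \<le> b" "b < length p" for a b
  proof -
    \<comment> \<open>The segment from index \<open>a\<close> to index \<open>b\<close>: it has
      \<open>Suc (b - a)\<close> vertices, hence \<open>b - a\<close> arcs.\<close>
    let ?q = "take (Suc (b - a)) (drop a p)"
    have "vwalk (?q @ drop (Suc (b - a)) (drop a p)) G"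
      using that vwalkI_append_r[of "drop a p" "take a p"] g(1) by (simp del: drop_drop)
    then have "vwalk ?q G"
      using that vwalkI_append_l[of ?q] by auto
    moreover have len: "length ?q = Suc (b - a)" using that by auto
    then have "?q \<noteq> []" by fastforce
    with len that have "hd ?q = p ! a" "last ?q = p ! b"
      by (auto simp: hd_drop_conv_nth last_conv_nth)
    ultimately show ?thesis using vdist_le[of ?q G] by simp
  qed
  let ?n = "length p - 1"
  have V: "p ! k \<in> pverts G" if "k < length p" for k
    using g(1) that by (auto simp: vwalk_def)
  have n: "?n < length p" "vdist G (p ! 0) (p ! ?n) = ?n"
    using g by (auto simp: hd_conv_nth last_conv_nth)
  have "?n \<le> vdist G (p ! 0) (p ! i) + (vdist G (p ! i) (p ! j) + vdist G (p ! j) (p ! ?n))"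
    using vdist_triangle[OF V V V, of 0 i ?n] vdist_triangle[OF V V V, of i j ?n] n ij by linarith
  with le[of 0 i] le[of i j] le[of j ?n] ij n show ?thesis by linarith
qed

text \<open>Lying on a geodesic becomes an equation between distances, so only the distance function
  of the prism has to be known later. Given the equation, two geodesics joined at \<open>x\<close>
  form a walk of length \<open>vdist G u v\<close>, and it remains to see that this walk is a
  path.\<close>

lemma geodesic_between_iff:
  assumes "u \<in> pverts G" "v \<in> pverts G" "x \<in> pverts G"
  shows "(\<exists>p. geodesic G p \<and> hd p = u \<and> last p = v \<and> x \<in> set p)
    \<longleftrightarrow> vdist G u v = vdist G u x + vdist G x v"
proof
  assume "\<exists>p. geodesic G p \<and> hd p = u \<and> last p = v \<and> x \<in> set p"
  then obtain p i where p: "geodesic G p" "hd p = u" "last p = v" "i < length p" "p ! i = x"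
    by (auto simp: in_set_conv_nth)
  with vdist_geodesic_nth[OF p(1), of 0 i] vdist_geodesic_nth[OF p(1), of i "length p - 1"]
    geodesicD[OF p(1)]
  show "vdist G u v = vdist G u x + vdist G x v"
    by (simp add: hd_conv_nth last_conv_nth)
next
  assume eq: "vdist G u v = vdist G u x + vdist G x v"
  obtain p where p: "geodesic G p" "hd p = u" "last p = x" using assms ex_geodesic by blast
  obtain q where q: "geodesic G q" "hd q = x" "last q = v" using assms ex_geodesic by blast
  note g = geodesicD[OF p(1)] geodesicD[OF q(1)]
  have j: "joinable p q" using p q g by (auto simp: joinable_def)
  have w: "vwalk (p \<oplus> q) G" using g j by (intro vwalk_joinI_vwalk) auto
  have hl: "hd (p \<oplus> q) = u" "last (p \<oplus> q) = v" 
    using p q j by (simp_all add: vwalk_join_hd vwalk_join_last)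
  have len: "length (p \<oplus> q) = Suc (vdist G u v)"
    using p q g eq by (simp add: vwalk_join_def)
  \<comment> \<open>If some \<open>y\<close> occurred twice, the pieces up to one occurrence and
    from a later one on would bound the distance by \<open>length a + length c\<close>, while the
    walk has at least one arc more.\<close>
  have dist: "distinct (p \<oplus> q)"
  proof (rule ccontr)
    assume "\<not> distinct (p \<oplus> q)"
    then obtain a y b c where abc: "p \<oplus> q = a @ [y] @ b @ [y] @ c"
      using not_distinct_decomp by blast
    have vw: "vwalk (a @ [y]) G" "vwalk ([y] @ c) G"
      using w vwalkI_append_l[of "a @ [y]" "b @ [y] @ c"] vwalkI_append_r[of "[y] @ c" "a @ [y] @ b"]
      unfolding abc by auto
    have "y \<in> pverts G" using vw(2) by (auto simp: vwalk_def)
    with vdist_triangle[of u y v] vdist_le[OF vw(1)] vdist_le[OF vw(2)] hl len abc assms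
    have "vdist G u v \<le> length a + length c"
      by (cases a; cases c rule: rev_cases) auto
    with len abc show False by simp
  qed
  have "geodesic G (p \<oplus> q)"
    using w dist hl len by (simp add: geodesic_def vpath_def)
  moreover have "x \<in> set (p \<oplus> q)"
    using p g by (auto simp: vwalk_join_def)
  ultimately show "\<exists>p. geodesic G p \<and> hd p = u \<and> last p = v \<and> x \<in> set p"
    using hl by blast
qed

lemma gp_set_iff_vdist:
  "gp_set G S \<longleftrightarrow> S \<subseteq> pverts G \<and>
    (\<forall>u \<in> S. \<forall>x \<in> S. \<forall>v \<in> S. u \<noteq> x \<and> v \<noteq> x \<and> u \<noteq> v \<longrightarrow> vdist G u v \<noteq> vdist G u x + vdist G x v)"
proof (cases "S \<subseteq> pverts G")
  case True
  have "(\<exists>p. geodesic G p \<and> hd p = u \<and> last p = v \<and> x \<in> set p)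
    \<longleftrightarrow> vdist G u v = vdist G u x + vdist G x v" if "u \<in> S" "v \<in> S" "x \<in> S" for u v x
    using True that by (intro geodesic_between_iff) auto
  then have "gp_set G S \<longleftrightarrow> (\<forall>x \<in> S. \<forall>u \<in> S - {x}. \<forall>v \<in> S - {x}. u \<noteq> v \<longrightarrow>
      vdist G u v \<noteq> vdist G u x + vdist G x v)"
    unfolding gp_set_def using True by simp
  with True show ?thesis by blast
qed (simp add: gp_set_def)

text \<open>Of three vertices on a geodesic, the outer two are the ends of a segment that is again
  geodesic and no longer than the whole. So a forbidden triple can be tested with its outer vertices
  as end vertices.\<close>

lemma three_gp_set_iff_vdist:
  "three_gp_set G S \<longleftrightarrow> S \<subseteq> pverts G \<and>
    (\<forall>u \<in> S. \<forall>x \<in> S. \<forall>v \<in> S. u \<noteq> x \<and> v \<noteq> x \<and> u \<noteq> v \<longrightarrow>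
       \<not> (vdist G u v = vdist G u x + vdist G x v \<and> vdist G u v \<le> 3))"
  (is "_ \<longleftrightarrow> _ \<and> ?R")
proof -
  let ?L = "\<exists>x \<in> S. \<exists>y \<in> S. \<exists>z \<in> S. x \<noteq> y \<and> x \<noteq> z \<and> y \<noteq> z \<and>
    (\<exists>p. geodesic G p \<and> vwalk_length p \<le> 3 \<and> {x, y, z} \<subseteq> set p)"
  have "?L \<longleftrightarrow> \<not> ?R" if sub: "S \<subseteq> pverts G"
  proof
    assume ?L
    then obtain x y z p where xyz: "x \<in> S" "y \<in> S" "z \<in> S" "x \<noteq> y" "x \<noteq> z" "y \<noteq> z"
      and p: "geodesic G p" "length p - 1 \<le> 3" "{x, y, z} \<subseteq> set p" 
      by auto
    from p(3) obtain i j k where ijk: "i < length p" "j < length p" "k < length p"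
      "p ! i = x" "p ! j = y" "p ! k = z"
      by (auto simp: in_set_conv_nth)
    have *: "\<not> ?R" if "a < b" "b < c" "c < length p" "p ! a \<in> S" "p ! b \<in> S" "p ! c \<in> S" for a b c
    proof -
      have d: "vdist G (p ! a) (p ! c) = c - a" "vdist G (p ! a) (p ! b) = b - a" "vdist G (p ! b) (p ! c) = c - b"
        using vdist_geodesic_nth[OF p(1)] that by auto
      moreover have "distinct p" using p by (auto simp: geodesic_def vpath_def)
      then have "p ! a \<noteq> p ! b" "p ! c \<noteq> p ! b" "p ! a \<noteq> p ! c"
        using that by (auto simp: nth_eq_iff_index_eq)
      moreover have "c - a = (b - a) + (c - b)" "c - a \<le> 3"
        using that p(2) by auto
      ultimately show ?thesis using that by metis
    qed
    have "i \<noteq> j" "i \<noteq> k" "j \<noteq> k" using ijk xyz by auto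
    \<comment> \<open>All six orders of the positions reduce to \<open>*\<close>, because the
      condition ranges over all ordered triples of \<open>S\<close>.\<close>
    then consider "i < j \<and> j < k" | "i < k \<and> k < j" | "j < i \<and> i < k" | "j < k \<and> k < i"
      | "k < i \<and> i < j" | "k < j \<and> j < i" by linarith
    then show "\<not> ?R" 
      using *[of i j k] *[of i k j] *[of j i k] *[of j k i] *[of k i j] *[of k j i] ijk xyz
      by cases metis+
  next
    assume "\<not> ?R"
    then obtain u x v where S: "u \<in> S" "x \<in> S" "v \<in> S" and ne: "u \<noteq> x" "v \<noteq> x" "u \<noteq> v"
      and d: "vdist G u v = vdist G u x + vdist G x v" "vdist G u v \<le> 3"
      by blast
    with geodesic_between_iff[of u v x] sub obtain p
      where p: "geodesic G p" "hd p = u" "last p = v" "x \<in> set p" by blast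
    moreover have "vwalk_length p \<le> 3" "{u, x, v} \<subseteq> set p"
      using geodesicD[OF p(1)] p d by auto
    ultimately show ?L using S ne by (metis (no_types, lifting))
  qed
  then show ?thesis unfolding three_gp_set_def by blast
qed

end

text \<open>With \<open>v\<close> in the middle of a triple, the outer distance would be 2 + 2 > 3.
  With \<open>v\<close> at an end, 2 = 2 + d would force d = 0, that is, two equal vertices.\<close>

lemma (in connected_pair_graph) three_gp_set_insert:
  assumes "three_gp_set G X" "v \<in> pverts G" "\<And>x. x \<in> X \<Longrightarrow> vdist G x v = 2"
  shows "three_gp_set G (insert v X)"
proof -
  have X: "X \<subseteq> pverts G" using assms(1) by (simp add: three_gp_set_def)
  have sym: "vdist G v x = 2" if "x \<in> X" for x
    using that assms vdist_commute[of x v] X by auto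
  have pos: "vdist G x y \<noteq> 0" if "x \<in> X" "y \<in> X" "x \<noteq> y" for x y
    using that vdist_eq_0_iff X by auto
  show ?thesis
    using assms X sym pos unfolding three_gp_set_iff_vdist by (auto 0 0)
qed

section \<open>Eccentricity and radius\<close>

lemma (in pair_graph) ecc_le_iff:
  assumes "v \<in> pverts G"
  shows "ecc G v \<le> k \<longleftrightarrow> (\<forall>u \<in> pverts G. vdist G v u \<le> k)"
proof -
  have "{vdist G v u | u. u \<in> pverts G} = vdist G v ` pverts G" by auto
  then show ?thesis
    unfolding ecc_def using assms pair_finite_verts by (subst Max_le_iff) auto
qed

lemma (in connected_pair_graph) rad_ge_iff:
  "k \<le> rad G \<longleftrightarrow> (\<forall>v \<in> pverts G. k \<le> ecc G v)"
proof -
  have "{ecc G v | v. v \<in> pverts G} = ecc G ` pverts G" by auto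
  moreover have "pverts G \<noteq> {}"
    using strongly_connected by (simp add: strongly_connected_def)
  ultimately show ?thesis
    unfolding rad_def using pair_finite_verts by (subst Min_ge_iff) auto
qed

section \<open>The complement and the prism as graphs\<close>

lemma (in pair_graph) pair_graph_complement: "pair_graph (complement G)"
proof
  show "finite (parcs (complement G))"
    by (rule finite_subset[of _ "pverts G \<times> pverts G"]) (auto simp: complement_def)
  show "symmetric (complement G)"
    by (auto simp: complement_def symmetric_def sym_def dest: arcs_symmetric)
qed (auto simp: complement_def)

lemma (in pair_graph) pair_graph_comp_prism: "pair_graph (comp_prism G)"
proof -
  interpret C: pair_graph "complement G" by (rule pair_graph_complement)
  have fin: "finite (pverts G <+> pverts (complement G))"
    using pair_finite_verts C.pair_finite_verts by simp
  show ?thesis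
  proof
    have "parcs (comp_prism G) \<subseteq> pverts (comp_prism G) \<times> pverts (comp_prism G)"
      using in_arcsD1 in_arcsD2 C.in_arcsD1 C.in_arcsD2
      by (auto simp: comp_prism_def) (auto simp: complement_def)
    with fin show "finite (parcs (comp_prism G))"
      by (metis (mono_tags, lifting) comp_prism_def finite_SigmaI finite_subset pair_pre_digraph.select_convs(1))
    show "symmetric (comp_prism G)"
      using arcs_symmetric C.arcs_symmetric by (auto simp: comp_prism_def symmetric_def sym_def)
  qed (use fin in \<open>auto simp: comp_prism_def complement_def in_arcsD1 in_arcsD2 no_loops'\<close>)
qed

lemma (in pair_graph) connected_pair_graphI:
  assumes "connected G"
  shows "connected_pair_graph G"
  by unfold_locales (use symmetric_connected_imp_strongly_connected pair_sym_arcs assms in blast)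

locale connected_pair_graph_complement = connected_pair_graph +
  assumes strongly_connected_complement: "strongly_connected (complement G)"
begin

sublocale C: connected_pair_graph "complement G"
proof -
  interpret C: pair_graph "complement G" by (rule pair_graph_complement)
  show "connected_pair_graph (complement G)"
    by unfold_locales (rule strongly_connected_complement)
qed

lemma pverts_complement [simp]: "pverts (complement G) = pverts G"
  by (simp add: complement_def)

lemma parcs_complement_iff:
  "(u, v) \<in> parcs (complement G) \<longleftrightarrow> u \<in> pverts G \<and> v \<in> pverts G \<and> u \<noteq> v \<and> (u, v) \<notin> parcs G"
  by (simp add: complement_def)

lemma pverts_prism [simp]: "pverts (comp_prism G) = pverts G <+> pverts G"
  by (simp add: comp_prism_def)

lemma parcs_prism_simps [simp]:
  "(Inl u, Inl v) \<in> parcs (comp_prism G) \<longleftrightarrow> (u, v) \<in> parcs G"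
  "(Inr u, Inr v) \<in> parcs (comp_prism G) \<longleftrightarrow> (u, v) \<in> parcs (complement G)"
  "(Inl u, Inr v) \<in> parcs (comp_prism G) \<longleftrightarrow> u = v \<and> u \<in> pverts G"
  "(Inr u, Inl v) \<in> parcs (comp_prism G) \<longleftrightarrow> u = v \<and> u \<in> pverts G"
  by (auto simp: comp_prism_def)

text \<open>Distinct \<open>u\<close> and \<open>v\<close> are adjacent in the graph or in its
  complement, so \<open>Inl u\<close> reaches \<open>Inl v\<close> along an edge or by the detour
  through \<open>Inr u\<close> and \<open>Inr v\<close>. Every \<open>Inr\<close> vertex is tied to
  its partner.\<close>

sublocale P: connected_pair_graph "comp_prism G"
proof -
  interpret P: pair_graph "comp_prism G" by (rule pair_graph_comp_prism)
  have LR: "Inl u \<rightarrow>\<^sup>*\<^bsub>comp_prism G\<^esub> Inr u" "Inr u \<rightarrow>\<^sup>*\<^bsub>comp_prism G\<^esub> Inl u" if "u \<in> pverts G" for u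
    using that by (intro P.reachable_adjI; simp)+
  have LL: "Inl u \<rightarrow>\<^sup>*\<^bsub>comp_prism G\<^esub> Inl v" if uv: "u \<in> pverts G" "v \<in> pverts G" for u v
  proof -
    consider "u = v" | "(u, v) \<in> parcs G" | "(u, v) \<in> parcs (complement G)"
      using uv by (auto simp: complement_def)
    then show ?thesis
    proof cases
      case 3
      then have "Inr u \<rightarrow>\<^sup>*\<^bsub>comp_prism G\<^esub> Inr v" by (intro P.reachable_adjI) simp
      from P.reachable_trans[OF P.reachable_trans[OF LR(1) this] LR(2)] show ?thesis
        using uv by blast
    next
      case 2
      then show ?thesis by (intro P.reachable_adjI) simp
    next
      case 1
      then show ?thesis using uv by (simp add: P.reachable_refl)
    qed
  qed
  show "connected_pair_graph (comp_prism G)"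
  proof
    have "u \<rightarrow>\<^sup>*\<^bsub>comp_prism G\<^esub> v" if "u \<in> pverts (comp_prism G)" "v \<in> pverts (comp_prism G)" for u v
    proof -
      have cop: "\<exists>a \<in> pverts G. x \<rightarrow>\<^sup>*\<^bsub>comp_prism G\<^esub> Inl a \<and> Inl a \<rightarrow>\<^sup>*\<^bsub>comp_prism G\<^esub> x"
        if "x \<in> pverts (comp_prism G)" for x
        using that
      proof (cases x)
        case (Inl a)
        then show ?thesis using that LL[of a a] by (intro bexI[of _ a]) auto
      next
        case (Inr a)
        then show ?thesis using that LR[of a] by (intro bexI[of _ a]) auto
      qed
      show ?thesis
        using cop[OF that(1)] cop[OF that(2)] LL by (blast intro: P.reachable_trans)
    qed
    moreover have "pverts G \<noteq> {}"
      using strongly_connected by (auto simp: strongly_connected_def)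
    ultimately show "strongly_connected (comp_prism G)"
      by (auto simp: strongly_connected_def)
  qed
qed

section \<open>Distances in the prism\<close>

lemma vdist_prism_cross:
  assumes "u \<in> pverts G" "v \<in> pverts G"
  shows "vdist (comp_prism G) (Inl u) (Inr v) = (if u = v then 1 else 2)"
    and "vdist (comp_prism G) (Inr u) (Inl v) = (if u = v then 1 else 2)"
proof -
  have *: "vdist (comp_prism G) (Inl u) (Inr v) = (if u = v then 1 else 2)"
    if "u \<in> pverts G" "v \<in> pverts G" for u v
  proof -
    have uv: "Inl u \<in> pverts (comp_prism G)" "Inr v \<in> pverts (comp_prism G)"
      using that by auto
    \<comment> \<open>For distinct \<open>u\<close> and \<open>v\<close> the middle vertex is
      \<open>Inl v\<close> if they are adjacent in the graph, and \<open>Inr u\<close> if they are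
      adjacent in the complement.\<close>
    have "vdist (comp_prism G) (Inl u) (Inr v) \<le> 2"
      unfolding P.vdist_le_2_iff[OF uv] using that parcs_complement_iff parcs_prism_simps by metis
    moreover have "vdist (comp_prism G) (Inl u) (Inr v) \<le> 1 \<longleftrightarrow> u = v"
      unfolding P.vdist_le_1_iff[OF uv] using that by auto
    moreover have "vdist (comp_prism G) (Inl u) (Inr v) \<noteq> 0"
      unfolding P.vdist_eq_0_iff[OF uv] by simp
    ultimately show ?thesis by auto
  qed
  show "vdist (comp_prism G) (Inl u) (Inr v) = (if u = v then 1 else 2)"
    by (rule *[OF assms])
  show "vdist (comp_prism G) (Inr u) (Inl v) = (if u = v then 1 else 2)"
    using *[OF assms(2,1)] P.vdist_commute[of "Inr u" "Inl v"] assms by auto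
qed

text \<open>Crossing to the partner of the target and back takes at most 2 + 1 steps. A path with at
  most two arcs between vertices of one copy cannot leave it, since crossing twice in a row only
  returns. So the thresholds 0, 1 and 2 agree with those of the copy, which together with the bound
  3 determines the value.\<close>

lemma vdist_prism_same:
  assumes "u \<in> pverts G" "v \<in> pverts G"
  shows "vdist (comp_prism G) (Inl u) (Inl v) = min 3 (vdist G u v)"
    and "vdist (comp_prism G) (Inr u) (Inr v) = min 3 (vdist (complement G) u v)"
proof -
  have l: "Inl u \<in> pverts (comp_prism G)" "Inl v \<in> pverts (comp_prism G)"
    and r: "Inr u \<in> pverts (comp_prism G)" "Inr v \<in> pverts (comp_prism G)"
    and c: "u \<in> pverts (complement G)" "v \<in> pverts (complement G)"
    using assms by auto
  have "vdist (comp_prism G) (Inl u) (Inl v) \<le> 3" 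
    using P.vdist_triangle[OF l(1) r(2) l(2)] vdist_prism_cross[of u v] vdist_prism_cross[of v v] assms
    by (auto split: if_splits)
  moreover have "vdist (comp_prism G) (Inl u) (Inl v) \<le> 2 \<longleftrightarrow> vdist G u v \<le> 2"
    unfolding P.vdist_le_2_iff[OF l] vdist_le_2_iff[OF assms] by (auto simp: split_sum_ex)
  moreover have "vdist (comp_prism G) (Inl u) (Inl v) \<le> 1 \<longleftrightarrow> vdist G u v \<le> 1"
    unfolding P.vdist_le_1_iff[OF l] vdist_le_1_iff[OF assms] by simp
  moreover have "vdist (comp_prism G) (Inl u) (Inl v) = 0 \<longleftrightarrow> vdist G u v = 0"
    unfolding P.vdist_eq_0_iff[OF l] vdist_eq_0_iff[OF assms] by simp
  ultimately show "vdist (comp_prism G) (Inl u) (Inl v) = min 3 (vdist G u v)"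
    by linarith
  have "vdist (comp_prism G) (Inr u) (Inr v) \<le> 3" 
    using P.vdist_triangle[OF r(1) l(2) r(2)] vdist_prism_cross[of u v] vdist_prism_cross[of v v] assms
    by (auto split: if_splits)
  moreover have "vdist (comp_prism G) (Inr u) (Inr v) \<le> 2 \<longleftrightarrow> vdist (complement G) u v \<le> 2"
    unfolding P.vdist_le_2_iff[OF r] C.vdist_le_2_iff[OF c] by (auto simp: split_sum_ex parcs_complement_iff)
  moreover have "vdist (comp_prism G) (Inr u) (Inr v) \<le> 1 \<longleftrightarrow> vdist (complement G) u v \<le> 1"
    unfolding P.vdist_le_1_iff[OF r] C.vdist_le_1_iff[OF c] by simp
  moreover have "vdist (comp_prism G) (Inr u) (Inr v) = 0 \<longleftrightarrow> vdist (complement G) u v = 0"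
    unfolding P.vdist_eq_0_iff[OF r] C.vdist_eq_0_iff[OF c] by simp
  ultimately show "vdist (comp_prism G) (Inr u) (Inr v) = min 3 (vdist (complement G) u v)"
    by linarith
qed

lemmas vdist_prism = vdist_prism_same vdist_prism_cross

section \<open>General position sets of the prism\<close>

lemma gp_set_prism_iff:
  assumes A: "A \<subseteq> pverts G" and B: "B \<subseteq> pverts G"
  shows "gp_set (comp_prism G) (A <+> B) \<longleftrightarrow> three_gp_set G A \<and> three_gp_set (complement G) B \<and>
    (\<forall>v \<in> A \<inter> B. (\<forall>u \<in> A - {v}. vdist G u v = 2) \<and> (\<forall>u \<in> B - {v}. vdist (complement G) u v = 2))"
    (is "?L \<longleftrightarrow> ?R1 \<and> ?R2 \<and> ?R3")
proof -
  let ?d = "vdist G" and ?e = "vdist (complement G)" and ?p = "vdist (comp_prism G)"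
  have pos: "?d u v \<noteq> 0" "?e u v \<noteq> 0" if "u \<in> pverts G" "v \<in> pverts G" "u \<noteq> v" for u v
    using that vdist_eq_0_iff C.vdist_eq_0_iff by auto
  have L: "?p u v \<noteq> ?p u x + ?p x v"
    if ?L "u \<in> A <+> B" "x \<in> A <+> B" "v \<in> A <+> B" "u \<noteq> x" "v \<noteq> x" "u \<noteq> v" for u x v
    using that unfolding P.gp_set_iff_vdist by blast
  show ?thesis
  proof (intro iffI conjI)
    assume ?L
    show ?R1
      unfolding three_gp_set_iff_vdist
    proof (intro conjI ballI impI notI A; elim conjE)
      fix u x v assume "u \<in> A" "x \<in> A" "v \<in> A" "u \<noteq> x" "v \<noteq> x" "u \<noteq> v"
        "?d u v = ?d u x + ?d x v" "?d u v \<le> 3"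
      \<comment> \<open>All three distances are at most 3, so truncation leaves them unchanged and
        the equation carries over to the prism.\<close>
      then show False
        using L[OF \<open>?L\<close>, of "Inl u" "Inl x" "Inl v"] A vdist_prism by (auto simp: subset_iff)
    qed
    show ?R2
      unfolding C.three_gp_set_iff_vdist pverts_complement
    proof (intro conjI ballI impI notI B; elim conjE)
      fix u x v assume "u \<in> B" "x \<in> B" "v \<in> B" "u \<noteq> x" "v \<noteq> x" "u \<noteq> v"
        "?e u v = ?e u x + ?e x v" "?e u v \<le> 3"
      then show False
        using L[OF \<open>?L\<close>, of "Inr u" "Inr x" "Inr v"] B vdist_prism by (auto simp: subset_iff)
    qed
    show ?R3
    proof (intro ballI conjI)
      fix v u assume v: "v \<in> A \<inter> B" and u: "u \<in> A - {v}"
      then have V: "u \<in> pverts G" "v \<in> pverts G" "u \<noteq> v" using A by auto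
      \<comment> \<open>For a neighbour \<open>u\<close> of \<open>v\<close>, the cross distance 2 =
        1 + 1 would put \<open>Inl v\<close> between \<open>Inl u\<close> and
        \<open>Inr v\<close>.\<close>
      have "?d u v \<noteq> 1"
        using L[OF \<open>?L\<close>, of "Inl u" "Inl v" "Inr v"] u v V by (auto simp: vdist_prism)
      \<comment> \<open>At distance 3 or more, the prism distance 3 = 2 + 1 would put
        \<open>Inr v\<close> between \<open>Inl u\<close> and \<open>Inl v\<close>.\<close>
      moreover have "min 3 (?d u v) \<noteq> 3"
        using L[OF \<open>?L\<close>, of "Inl u" "Inr v" "Inl v"] u v V by (auto simp: vdist_prism)
      ultimately show "?d u v = 2" using pos[OF V] by linarith
    next
      fix v u assume v: "v \<in> A \<inter> B" and u: "u \<in> B - {v}"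
      then have V: "u \<in> pverts G" "v \<in> pverts G" "u \<noteq> v" using B by auto
      have "?e u v \<noteq> 1"
        using L[OF \<open>?L\<close>, of "Inr u" "Inr v" "Inl v"] u v V by (auto simp: vdist_prism)
      moreover have "min 3 (?e u v) \<noteq> 3"
        using L[OF \<open>?L\<close>, of "Inr u" "Inl v" "Inr v"] u v V by (auto simp: vdist_prism)
      ultimately show "?e u v = 2" using pos[OF V] by linarith
    qed
  next
    assume R: "?R1 \<and> ?R2 \<and> ?R3"
    have R1: "\<not> (?d u v = ?d u x + ?d x v \<and> ?d u v \<le> 3)"
      if "u \<in> A" "x \<in> A" "v \<in> A" "u \<noteq> x" "v \<noteq> x" "u \<noteq> v" for u x v
      using R that unfolding three_gp_set_iff_vdist by blast
    have R2: "\<not> (?e u v = ?e u x + ?e x v \<and> ?e u v \<le> 3)"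
      if "u \<in> B" "x \<in> B" "v \<in> B" "u \<noteq> x" "v \<noteq> x" "u \<noteq> v" for u x v
      using R that unfolding C.three_gp_set_iff_vdist by blast
    have R3: "?d u v = 2" "?d v u = 2" if "v \<in> A" "v \<in> B" "u \<in> A" "u \<noteq> v" for u v
      using R that vdist_commute[of u v] A by auto
    have R4: "?e u v = 2" "?e v u = 2" if "v \<in> A" "v \<in> B" "u \<in> B" "u \<noteq> v" for u v
      using R that C.vdist_commute[of u v] B by auto
    have "?p u v \<noteq> ?p u x + ?p x v"
      if "u \<in> A <+> B" "x \<in> A <+> B" "v \<in> A <+> B" "u \<noteq> x" "v \<noteq> x" "u \<noteq> v" for u x v
    proof
      assume eq: "?p u v = ?p u x + ?p x v"
      \<comment> \<open>If the three were distinct, both summands would be positive with sum at most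
        3, hence not truncated. The triangle inequality then bounds the left side by 3, so the
        equation holds for \<open>?d\<close> itself, against \<open>R1\<close>.\<close>
      have dA: "a = b \<or> c = b \<or> a = c"
        if "min 3 (?d a c) = min 3 (?d a b) + min 3 (?d b c)" "a \<in> A" "b \<in> A" "c \<in> A" for a b c
        using R1[of a b c] pos[of a b] pos[of b c] vdist_triangle[of a b c] that A
        by (auto simp: subset_iff min_def split: if_splits)
      have dB: "a = b \<or> c = b \<or> a = c"
        if "min 3 (?e a c) = min 3 (?e a b) + min 3 (?e b c)" "a \<in> B" "b \<in> B" "c \<in> B" for a b c
        using R2[of a b c] pos[of a b] pos[of b c] C.vdist_triangle[of a b c] that B
        by (auto simp: subset_iff min_def split: if_splits)
      \<comment> \<open>These settle mixed triples without partners: two cross distances around the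
        middle vertex add up to 4, and 2 = k + 2 forces k = 0.\<close>
      have min0: "min 3 k = 0 \<longleftrightarrow> k = 0" "min 3 k \<noteq> 4" for k :: nat by auto
      have V: "a \<in> pverts G" if "a \<in> A \<or> a \<in> B" for a using that A B by auto
      show False
        using that eq
        by (auto simp: vdist_prism V R3 R4 min0 vdist_eq_0_iff C.vdist_eq_0_iff split: if_splits dest: dA dB)
    qed
    then show ?L
      unfolding P.gp_set_iff_vdist using A B by auto
  qed
qed

lemma card_Int_le_1_of_gp_set_prism:
  assumes A: "A \<subseteq> pverts G" and B: "B \<subseteq> pverts G" and gp: "gp_set (comp_prism G) (A <+> B)"
  shows "card (A \<inter> B) \<le> 1"
proof -
  have "u = v" if uv: "u \<in> A \<inter> B" "v \<in> A \<inter> B" for u v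
  proof (rule ccontr)
    assume "u \<noteq> v"
    with uv gp have "vdist G u v = 2" "vdist (complement G) u v = 2"
      unfolding gp_set_prism_iff[OF A B] by auto
    moreover have V: "u \<in> pverts G" "v \<in> pverts G" using uv A by auto
    ultimately show False
      using vdist_le_1_iff[OF V] C.vdist_le_1_iff[of u v] \<open>u \<noteq> v\<close> by (auto simp: parcs_complement_iff)
  qed
  moreover have "finite (A \<inter> B)"
    using finite_subset[OF A pair_finite_verts] by simp
  ultimately show ?thesis by (simp add: card_le_Suc0_iff_eq)
qed

lemma gp_set_prism_Plus:
  assumes "gp_set (comp_prism G) S"
  obtains A B where "S = A <+> B" "A \<subseteq> pverts G" "B \<subseteq> pverts G"
proof
  have sub: "S \<subseteq> pverts G <+> pverts G"
    using assms by (simp add: gp_set_def)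
  show "S = Inl -` S <+> Inr -` S"
  proof (rule set_eqI)
    show "x \<in> S \<longleftrightarrow> x \<in> Inl -` S <+> Inr -` S" for x by (cases x) simp_all
  qed
  show "Inl -` S \<subseteq> pverts G" "Inr -` S \<subseteq> pverts G"
    using sub by auto
qed

text \<open>In this form the bound n + 1 splits: the union accounts for at most n, the intersection
  for at most 1.\<close>

lemma card_Plus_subsets:
  assumes "A \<subseteq> pverts G" "B \<subseteq> pverts G"
  shows "card (A <+> B) = card (A \<union> B) + card (A \<inter> B)"
  using assms[THEN finite_subset[OF _ pair_finite_verts]]
  by (simp add: card_Plus card_Un_Int[of A B])

lemma card_gp_set_prism_le:
  assumes "gp_set (comp_prism G) S"
  shows "card S \<le> card (pverts G) + 1"
proof -
  obtain A B where S: "S = A <+> B" and AB: "A \<subseteq> pverts G" "B \<subseteq> pverts G"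
    using gp_set_prism_Plus[OF assms] .
  have "card (A \<union> B) \<le> card (pverts G)"
    using AB pair_finite_verts by (intro card_mono) auto
  then show ?thesis
    using card_Int_le_1_of_gp_set_prism[OF AB] assms card_Plus_subsets[OF AB] S by simp
qed

text \<open>Since n + 1 is an upper bound, the maximum equals it exactly when it is attained. The
  empty set keeps \<open>Max\<close> off an empty argument.\<close>

lemma gp_prism_eq_iff:
  "gp (comp_prism G) = card (pverts G) + 1 \<longleftrightarrow>
    (\<exists>S. gp_set (comp_prism G) S \<and> card S = card (pverts G) + 1)"
proof -
  let ?M = "{card S | S. gp_set (comp_prism G) S}"
  have "?M \<subseteq> {..card (pverts G) + 1}" using card_gp_set_prism_le by auto
  then have fin: "finite ?M" by (rule finite_subset) simp
  have "gp_set (comp_prism G) {}" by (simp add: gp_set_def)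
  then have "?M \<noteq> {}" by blast
  have "gp (comp_prism G) = card (pverts G) + 1 \<longleftrightarrow> card (pverts G) + 1 \<in> ?M"
    unfolding gp_def Max_eq_iff[OF fin \<open>?M \<noteq> {}\<close>] using card_gp_set_prism_le by blast
  then show ?thesis by auto
qed

section \<open>Graphs of radius 2\<close>

lemma exists_nonadjacent:
  assumes "card (pverts G) \<ge> 2" "v \<in> pverts G"
  shows "\<exists>w \<in> pverts G. w \<noteq> v \<and> (v, w) \<notin> parcs G"
proof -
  have "\<not> pverts G \<subseteq> {v}"
    using assms(1) card_mono[of "{v}" "pverts G"] by auto
  then obtain u where "u \<in> pverts G" "u \<noteq> v" by auto
  \<comment> \<open>With the distance itself as \<open>k\<close>, the left side of
    \<open>vdist_le_Suc_iff\<close> is trivial, and as \<open>u\<close> differs from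
    \<open>v\<close> the right side yields the first arc of a path.\<close>
  moreover from this have "\<exists>w. (v, w) \<in> parcs (complement G)"
    using C.vdist_le_Suc_iff[of v u "vdist (complement G) v u"] assms(2) by auto
  ultimately show ?thesis by (auto simp: parcs_complement_iff)
qed

lemma rad_ge_2:
  assumes "card (pverts G) \<ge> 2"
  shows "rad G \<ge> 2"
  unfolding rad_ge_iff
proof
  fix v assume v: "v \<in> pverts G"
  obtain w where w: "w \<in> pverts G" "w \<noteq> v" "(v, w) \<notin> parcs G"
    using exists_nonadjacent[OF assms v] by auto
  then have "\<not> vdist G v w \<le> 1" using v by (subst vdist_le_1_iff) auto
  then have "\<not> ecc G v \<le> 1" using ecc_le_iff[OF v] w by blast
  then show "2 \<le> ecc G v" by simp
qed

text \<open>No eccentricity is below 2, so a single vertex of eccentricity at most 2 gives radius 2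
  and is itself central.\<close>

lemma centre_rad_2_iff:
  assumes "card (pverts G) \<ge> 2"
  shows "rad G = 2 \<and> v \<in> centre G \<longleftrightarrow> v \<in> pverts G \<and> (\<forall>u \<in> pverts G. vdist G v u \<le> 2)"
proof -
  have "rad G = 2 \<and> ecc G v = rad G \<longleftrightarrow> ecc G v \<le> 2" if "v \<in> pverts G"
    using rad_ge_2[OF assms] rad_ge_iff[of "rad G"] that by auto
  then show ?thesis using ecc_le_iff by (auto simp: centre_def)
qed

end

theorem theorem3p4:
  fixes G :: "'a pair_pre_digraph"
  assumes "pair_graph G"
    and "card (pverts G) \<ge> 2"
    and "connected G"
    and "connected (complement G)"
  shows "gp (comp_prism G) = card (pverts G) + 1 \<longleftrightarrow>
    rad G = 2 \<and>
    (\<exists>v \<in> centre G.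
      (three_gp_set (complement G) (nbhd G v) \<and> three_gp_set G (nbhd2 G v)) \<and>
      (\<forall>x \<in> nbhd G v. \<exists>y \<in> nbhd2 G v. (x, y) \<notin> parcs G))"
    (is "_ \<longleftrightarrow> _ \<and> (\<exists>v \<in> centre G. ?gp v \<and> ?sep v)")
proof -
  interpret pair_graph G by fact
  interpret C: pair_graph "complement G" by (rule pair_graph_complement)
  interpret connected_pair_graph_complement G
    using connected_pair_graphI[OF assms(3)] C.connected_pair_graphI[OF assms(4)]
    by (auto simp: connected_pair_graph_complement_def connected_pair_graph_complement_axioms_def
        connected_pair_graph_def connected_pair_graph_axioms_def)
  let ?V = "pverts G"
  note centre_iff = centre_rad_2_iff[OF assms(2)]
  have nbhd_iff: "u \<in> nbhd G v \<longleftrightarrow> (v, u) \<in> parcs G" for u v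
    using in_arcsD2 by (auto simp: nbhd_def)
  have nbhd2_iff: "u \<in> nbhd2 G v \<longleftrightarrow> u \<in> ?V \<and> vdist G u v = 2" for u v
    by (simp add: nbhd2_def)
  show ?thesis
  proof
    assume "gp (comp_prism G) = card ?V + 1"
    then obtain A B where gp: "gp_set (comp_prism G) (A <+> B)" and card: "card (A <+> B) = card ?V + 1"
      and A: "A \<subseteq> ?V" and B: "B \<subseteq> ?V"
      unfolding gp_prism_eq_iff using gp_set_prism_Plus by metis
    have le: "card (A \<union> B) \<le> card ?V" "card (A \<inter> B) \<le> 1"
      using A B pair_finite_verts card_Int_le_1_of_gp_set_prism[OF A B gp] by (auto intro: card_mono)
    \<comment> \<open>The two bounds add up to n + 1, so both are tight.\<close>
    with card card_Plus_subsets[OF A B] have "card (A \<union> B) = card ?V" "card (A \<inter> B) = 1"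
      by auto
    then obtain v where AB: "A \<union> B = ?V" "A \<inter> B = {v}"
      using A B pair_finite_verts card_subset_eq[of ?V "A \<union> B"] by (auto simp: card_1_singleton_iff)
    then have v: "v \<in> ?V" by auto
    from gp AB have gpA: "three_gp_set G A" and gpB: "three_gp_set (complement G) B"
      and dA: "\<And>u. u \<in> A \<Longrightarrow> u \<noteq> v \<Longrightarrow> vdist G u v = 2"
      and dB: "\<And>u. u \<in> B \<Longrightarrow> u \<noteq> v \<Longrightarrow> vdist (complement G) u v = 2"
      unfolding gp_set_prism_iff[OF A B] by auto
    have adjB: "(v, u) \<in> parcs G" if "u \<in> B" "u \<noteq> v" for u
    proof -
      have "\<not> vdist (complement G) u v \<le> 1" using dB that by simp
      then have "(u, v) \<in> parcs G"
        using C.vdist_le_1_iff[of u v] that B v by (auto simp: parcs_complement_iff)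
      then show ?thesis by (rule arcs_symmetric)
    qed
    have adjA: "(v, u) \<notin> parcs G" if "u \<in> A" for u
      using dA[OF that] vdist_le_1_iff[of u v] that A v arcs_symmetric no_loops' by fastforce
    have d1: "vdist G u v = 1" if "u \<in> B" "u \<noteq> v" for u
      using adjB[OF that] vdist_eq_1_iff[of u v] arcs_symmetric that B v by auto
    \<comment> \<open>Distance from \<open>v\<close> sorts the vertices: 0 for \<open>v\<close>, 2
      on the rest of \<open>A\<close>, 1 on the rest of \<open>B\<close>.\<close>
    have nA: "nbhd2 G v = A - {v}"
      using dA d1 A AB v by (force simp: nbhd2_iff)
    have nB: "nbhd G v = B - {v}"
      using adjA adjB AB in_arcsD2 no_loops' by (fastforce simp: nbhd_iff)
    have "vdist G v u \<le> 2" if "u \<in> ?V" for u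
    proof -
      from that AB have "u = v \<or> u \<in> A \<and> u \<noteq> v \<or> u \<in> B \<and> u \<noteq> v" by blast
      then show ?thesis using dA[of u] d1[of u] v vdist_commute[OF that v] by auto
    qed
    then have "rad G = 2 \<and> v \<in> centre G" using centre_iff v by blast
    moreover have "?gp v"
      using gpA gpB unfolding nA nB by (auto simp: three_gp_set_iff_vdist C.three_gp_set_iff_vdist)
    moreover have "?sep v"
    proof
      fix x assume "x \<in> nbhd G v"
      then have x: "x \<in> B" "x \<noteq> v" by (auto simp: nB)
      then have "vdist (complement G) x v \<le> 2" "\<not> vdist (complement G) x v \<le> 1"
        using dB by auto
      \<comment> \<open>A common neighbour \<open>y\<close> of \<open>x\<close> and \<open>v\<close>
        in the complement. It is not adjacent to \<open>v\<close> in the graph, so it misses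
        \<open>B\<close> and lies in the second neighbourhood, as condition (ii) demands.\<close>
      then obtain y where y: "(x, y) \<in> parcs (complement G)" "(y, v) \<in> parcs (complement G)"
        using C.vdist_le_2_iff[of x v] C.vdist_le_1_iff[of x v] x B v by auto
      then have "y \<in> A - {v}"
        using adjB arcs_symmetric AB by (auto simp: parcs_complement_iff)
      with y show "\<exists>y \<in> nbhd2 G v. (x, y) \<notin> parcs G"
        unfolding nA parcs_complement_iff by blast
    qed
    ultimately show "rad G = 2 \<and> (\<exists>v \<in> centre G. ?gp v \<and> ?sep v)" by blast
  next
    assume "rad G = 2 \<and> (\<exists>v \<in> centre G. ?gp v \<and> ?sep v)"
    then obtain v where "rad G = 2 \<and> v \<in> centre G" and gp: "?gp v" and sep: "?sep v"
      by blast
    then have v: "v \<in> ?V" and d2: "\<And>u. u \<in> ?V \<Longrightarrow> vdist G u v \<le> 2"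
      using vdist_commute by (auto simp: centre_iff)
    \<comment> \<open>The sets forced in the other direction, with \<open>v\<close> as the one
      vertex present in both copies.\<close>
    let ?A = "insert v (nbhd2 G v)" and ?B = "insert v (nbhd G v)"
    have A: "?A \<subseteq> ?V" and B: "?B \<subseteq> ?V" using v by (auto simp: nbhd_def nbhd2_def)
    have dB: "vdist (complement G) x v = 2" if x: "x \<in> nbhd G v" for x
    proof -
      \<comment> \<open>Condition (ii) provides the middle vertex of a path \<open>x\<close>,
        \<open>y\<close>, \<open>v\<close> in the complement: \<open>y\<close> has distance 2 from
        \<open>v\<close> in the graph and so is not adjacent to it there.\<close>
      from sep x obtain y where y: "y \<in> nbhd2 G v" "(x, y) \<notin> parcs G" by blast
      have vx: "(v, x) \<in> parcs G" and xv: "(x, v) \<in> parcs G" using x nbhd_iff arcs_symmetric by auto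
      have xV: "x \<in> ?V" "x \<noteq> v" using B x vx no_loops' by auto
      have yV: "y \<in> ?V" "vdist G y v = 2" using y by (auto simp: nbhd2_iff)
      have "x \<noteq> y" using vdist_eq_1_iff[of x v] xv yV v by auto
      moreover have "y \<noteq> v" "(y, v) \<notin> parcs G"
        using vdist_le_1_iff[of y v] yV v by auto
      ultimately have "vdist (complement G) x v \<le> 2"
        using C.vdist_le_2_iff[of x v] xV yV y v by (auto simp: parcs_complement_iff)
      moreover have "\<not> vdist (complement G) x v \<le> 1"
        using C.vdist_le_1_iff[of x v] xV v xv by (auto simp: parcs_complement_iff)
      ultimately show ?thesis by simp
    qed
    have dA: "vdist G u v = 2" if "u \<in> nbhd2 G v" for u using that by (simp add: nbhd2_iff)
    have disj: "nbhd2 G v \<inter> nbhd G v = {}"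
      using arcs_symmetric vdist_eq_1_iff[of _ v] v by (fastforce simp: nbhd_iff nbhd2_iff)
    have "three_gp_set G ?A" 
      using gp dA v by (intro three_gp_set_insert) auto
    moreover have "three_gp_set (complement G) ?B"
      using gp dB v by (intro C.three_gp_set_insert) auto
    moreover have Int: "?A \<inter> ?B = {v}" using disj by auto
    ultimately have gpS: "gp_set (comp_prism G) (?A <+> ?B)"
      unfolding gp_set_prism_iff[OF A B] using dA dB by auto
    \<comment> \<open>Every vertex is within distance 2 of the central vertex \<open>v\<close>, so
      it is \<open>v\<close>, a neighbour or in the second neighbourhood.\<close>
    have "?V \<subseteq> ?A \<union> ?B"
    proof
      fix u assume u: "u \<in> ?V"
      have "(v, u) \<in> parcs G" if "u \<noteq> v" "vdist G u v \<noteq> 2"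
        using that vdist_le_1_iff[OF u v] d2[OF u] arcs_symmetric by auto
      then show "u \<in> ?A \<union> ?B" using u by (auto simp: nbhd_iff nbhd2_iff)
    qed
    then have Un: "?A \<union> ?B = ?V" using A B by blast
    have "card (?A <+> ?B) = card ?V + 1"
      unfolding card_Plus_subsets[OF A B] Un Int by simp
    with gpS show "gp (comp_prism G) = card ?V + 1"
      unfolding gp_prism_eq_iff by blast
  qed
qed

end
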